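(* For any parameters $n,d\ge 1$, there exists a canonical partially observable Markov chain $M=(\Omega,P)$ with $n=|\Omega|$ states and two states $a,b\in\Omega$ such that $$\mathrm{AQC}_M(a,b)=O(n^2d),\qquad \mathrm{NAQC}_M(a,b)=\Omega\!\left(d^{(1-o(1))n}\right).$$
   Context: A canonical partially observable Markov chain $M=(\Omega,P)$ has finite state space $\Omega$, transition probabilities $P$ (from state $y$ the next state is drawn from $P(\cdot\mid y)$), a sink state $s$ with $P(s\mid s)=1$, and observation function $O(x)=1$ if $x=s$ and $0$ otherwise; states are hidden. A rewinding strategy is a (possibly randomized) function $A:\{0,1\}^*\to\mathbb{Z}_{\ge0}$: from initial state $X_0$, for $t\ge0$ set $Z_t=O(X_t)$ and draw $X_{t+1}\sim P(\cdot\mid X_{t'})$ with $t'=\max\{0,t-A(Z_0,\dots,Z_t)\}$, independently of everything else given $X_{t'}$ (each draw is a query); it is non-adaptive if $A(Z_0,\dots,Z_t)$ depends only on $t$. $\mathrm{QC}^A_M(a,b)$ is the least $T$ such that the total variation distance between $(Z_0,\dots,Z_T)$ under $X_0=a$ and under $X_0=b$ is at least $1/3$; $\mathrm{AQC}_M(a,b)=\min_A\mathrm{QC}^A_M(a,b)$ over all rewinding strategies and $\mathrm{NAQC}_M(a,b)$ the same minimum over non-adaptive ones.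
   Formalization: The statement is proved for n ≥ 3 instead of n ≥ 1: for n = 1 the two states coincide and AQC is infinite, and for n = 2 either they coincide or one is the sink, so NAQC = 0 and the lower bound fails. *)

theory Defs
  imports "HOL-Probability.Probability" "HOL-Library.Extended_Nat"
begin

record 'a pomc =
  states :: "'a set"
  trans :: "'a \<Rightarrow> 'a pmf"
  sink :: 'a

definition canonical_pomc :: "'a pomc \<Rightarrow> bool" where
  "canonical_pomc M \<longleftrightarrow>
     finite (states M) \<and> sink M \<in> states M \<and>
     (\<forall>y\<in>states M. set_pmf (trans M y) \<subseteq> states M) \<and>
     pmf (trans M (sink M)) (sink M) = 1"

text \<open>Observations are booleans, \<open>True\<close> standing for 1 (the sink) and \<open>False\<close> for 0.\<close>

definition observe :: "'a pomc \<Rightarrow> 'a \<Rightarrow> bool" where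
  "observe M x \<longleftrightarrow> x = sink M"

type_synonym strategy = "bool list \<Rightarrow> nat"

text \<open>
  Joint law of the hidden states \<open>[X\<^sub>0, \<dots>, X\<^sub>t]\<close> for a fixed (deterministic) strategy.
  Truncated subtraction on natural numbers is the maximum with 0 in the choice of the
  index to rewind to.
\<close>

primrec run :: "'a pomc \<Rightarrow> strategy \<Rightarrow> 'a \<Rightarrow> nat \<Rightarrow> 'a list pmf" where
  "run M A x0 0 = return_pmf [x0]"
| "run M A x0 (Suc t) =
     bind_pmf (run M A x0 t) (\<lambda>xs.
       map_pmf (\<lambda>x. xs @ [x]) (trans M (xs ! (t - A (map (observe M) xs)))))"

definition obs_run :: "'a pomc \<Rightarrow> strategy \<Rightarrow> 'a \<Rightarrow> nat \<Rightarrow> bool list pmf" where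
  "obs_run M A x0 T = map_pmf (map (observe M)) (run M A x0 T)"

text \<open>
  A randomized strategy is a random function, i.e. a probability measure on the space of
  deterministic strategies (with the product \<open>\<sigma>\<close>-algebra). Fresh independent coins for every
  call and coins shared between calls are both instances, as are deterministic strategies
  (point masses). The coins are independent of the chain and are not part of the observations.
\<close>

definition strategy_space :: "strategy measure" where
  "strategy_space = (\<Pi>\<^sub>M h\<in>UNIV. count_space UNIV)"

definition rewinding_strategies :: "strategy measure set" where
  "rewinding_strategies = space (prob_algebra strategy_space)"

definition nonadaptive :: "strategy measure \<Rightarrow> bool" where
  "nonadaptive \<mu> \<longleftrightarrow> (AE A in \<mu>. \<forall>h h'. length h = length h' \<longrightarrow> A h = A h')"

text \<open>Law of the observations \<open>[Z\<^sub>0, \<dots>, Z\<^sub>T]\<close> under a randomized strategy.\<close>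

definition obs_law :: "'a pomc \<Rightarrow> strategy measure \<Rightarrow> 'a \<Rightarrow> nat \<Rightarrow> bool list measure" where
  "obs_law M \<mu> x0 T = \<mu> \<bind> (\<lambda>A. measure_pmf (obs_run M A x0 T))"

definition tv_dist :: "'b measure \<Rightarrow> 'b measure \<Rightarrow> real" where
  "tv_dist p q = (SUP E\<in>sets p. \<bar>measure p E - measure q E\<bar>)"

text \<open>The infimum of the empty set is \<open>\<infinity>\<close>; that of a nonempty set of extended naturals is attained.\<close>

definition QC :: "'a pomc \<Rightarrow> strategy measure \<Rightarrow> 'a \<Rightarrow> 'a \<Rightarrow> enat" where
  "QC M \<mu> a b = Inf {enat T |T. tv_dist (obs_law M \<mu> a T) (obs_law M \<mu> b T) \<ge> 1/3}"

definition AQC :: "'a pomc \<Rightarrow> 'a \<Rightarrow> 'a \<Rightarrow> enat" where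
  "AQC M a b = (INF \<mu>\<in>rewinding_strategies. QC M \<mu> a b)"

definition NAQC :: "'a pomc \<Rightarrow> 'a \<Rightarrow> 'a \<Rightarrow> enat" where
  "NAQC M a b = (INF \<mu>\<in>{\<mu> \<in> rewinding_strategies. nonadaptive \<mu>}. QC M \<mu> a b)"

end

theory Submission
  imports Defs
begin

text \<open>
  From level \<open>k\<close> the chain descends to \<open>k - 1\<close> with probability \<open>p = 1/d\<close> and falls into the sink
  \<open>0\<close> otherwise; compare the starting levels \<open>n - 1\<close> and \<open>n - 2\<close>. An adaptive strategy
  retries from the last unsunk state, descends one level every \<open>d\<close> queries on average and counts
  the levels. A non-adaptive strategy fixes its query tree in advance. Lowering all levels by one
  turns the run from \<open>n - 1\<close> into the run from \<open>n - 2\<close>, and the observations change only if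
  the former visits level 1, which each query does with probability at most \<open>p ^ (n - 2)\<close>.
\<close>

section \<open>Observation laws and total variation distance\<close>

text \<open>For a fixed history the step reads a single coordinate of the random strategy, which is
  measurable in the product space; as the state type is countable, so are the histories, and the
  steps glue together.\<close>

lemma measurable_run:
  fixes M :: "'a::countable pomc"
  shows "(\<lambda>A. measure_pmf (run M A x t)) \<in> strategy_space \<rightarrow>\<^sub>M subprob_algebra (count_space UNIV)"
proof (induction t)
  case 0
  show ?case by (simp add: measure_pmf_in_subprob_space)
next
  case (Suc t)
  have step: "(\<lambda>A. measure_pmf (map_pmf (\<lambda>y. xs @ [y]) (trans M (xs ! (t - A (map (observe M) xs))))))
      \<in> strategy_space \<rightarrow>\<^sub>M subprob_algebra (count_space UNIV)" for xs
  proof (rule measurable_compose[where f = "\<lambda>A. A (map (observe M) xs)"])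
    show "(\<lambda>A. A (map (observe M) xs)) \<in> strategy_space \<rightarrow>\<^sub>M count_space UNIV"
      unfolding strategy_space_def by (rule measurable_component_singleton) simp
    show "(\<lambda>r. measure_pmf (map_pmf (\<lambda>y. xs @ [y]) (trans M (xs ! (t - r)))))
        \<in> count_space UNIV \<rightarrow>\<^sub>M subprob_algebra (count_space UNIV)"
      by (simp add: measure_pmf_in_subprob_space)
  qed
  have "(\<lambda>z. measure_pmf (map_pmf (\<lambda>y. snd z @ [y]) (trans M (snd z ! (t - fst z (map (observe M) (snd z)))))))
      \<in> strategy_space \<Otimes>\<^sub>M count_space UNIV \<rightarrow>\<^sub>M subprob_algebra (count_space UNIV)"
    by (rule measurable_compose_countable'[where I = UNIV and g = snd and
          f = "\<lambda>xs z. measure_pmf (map_pmf (\<lambda>y. xs @ [y]) (trans M (xs ! (t - fst z (map (observe M) xs)))))"])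
      (auto intro: measurable_compose[OF measurable_fst step])
  from measurable_bind[OF Suc this] show ?case
    by (simp add: measure_pmf_bind)
qed

lemma measurable_obs_run:
  fixes M :: "'a::countable pomc"
  shows "(\<lambda>A. measure_pmf (obs_run M A x t)) \<in> strategy_space \<rightarrow>\<^sub>M subprob_algebra (count_space UNIV)"
  unfolding obs_run_def map_pmf_rep_eq
  by (rule measurable_compose[OF measurable_run measurable_distr]) simp

context
  fixes \<mu> :: "strategy measure"
  assumes strategy: "\<mu> \<in> rewinding_strategies"
begin

lemma prob_space_strategy: "prob_space \<mu>"
  and sets_strategy: "sets \<mu> = sets strategy_space"
  using strategy by (auto simp: rewinding_strategies_def space_prob_algebra)

lemma measurable_obs_run_strategy:
  fixes M :: "'a::countable pomc"
  shows "(\<lambda>A. measure_pmf (obs_run M A x t)) \<in> \<mu> \<rightarrow>\<^sub>M subprob_algebra (count_space UNIV)"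
  using measurable_obs_run[of M x t] measurable_cong_sets[OF sets_strategy refl] by blast

lemma sets_obs_law: "sets (obs_law M \<mu> x t) = UNIV"
  unfolding obs_law_def using prob_space.not_empty[OF prob_space_strategy]
  by (subst sets_bind[where N = "count_space UNIV"]) auto

lemma measure_obs_law:
  fixes M :: "'a::countable pomc"
  shows "measure (obs_law M \<mu> x t) E = (\<integral>A. measure (obs_run M A x t) E \<partial>\<mu>)"
  unfolding obs_law_def
  by (rule subprob_space.measure_bind[OF prob_space_imp_subprob_space[OF prob_space_strategy]
        measurable_obs_run_strategy]) simp

lemma integrable_obs_run:
  fixes M :: "'a::countable pomc"
  shows "integrable \<mu> (\<lambda>A. measure (obs_run M A x t) E)"
  by (intro finite_measure.integrable_const_bound[where B = 1] prob_space.finite_measure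
        prob_space_strategy measurable_compose[OF measurable_obs_run_strategy measurable_measure_subprob_algebra])
     auto

text \<open>The law under a randomized strategy is a mixture over deterministic ones, so a bound on
  each event that holds for almost every fixed strategy survives averaging.\<close>

lemma tv_dist_obs_law_le:
  fixes M :: "'a::countable pomc"
  assumes "AE A in \<mu>. \<forall>E. \<bar>measure (obs_run M A x t) E - measure (obs_run M A y t) E\<bar> \<le> \<delta>"
  shows "tv_dist (obs_law M \<mu> x t) (obs_law M \<mu> y t) \<le> \<delta>"
  unfolding tv_dist_def
proof (rule cSUP_least)
  fix E
  interpret prob_space \<mu> by (rule prob_space_strategy)
  let ?D = "\<lambda>A. measure (obs_run M A x t) E - measure (obs_run M A y t) E"
  have int: "integrable \<mu> ?D" by (intro Bochner_Integration.integrable_diff integrable_obs_run)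
  have "\<bar>\<integral>A. ?D A \<partial>\<mu>\<bar> \<le> (\<integral>A. \<bar>?D A\<bar> \<partial>\<mu>)" by (rule integral_abs_bound)
  also have "\<dots> \<le> (\<integral>A. \<delta> \<partial>\<mu>)"
    using assms int by (intro integral_mono_AE) auto
  finally show "\<bar>measure (obs_law M \<mu> x t) E - measure (obs_law M \<mu> y t) E\<bar> \<le> \<delta>"
    by (simp add: measure_obs_law integrable_obs_run prob_space)
qed (simp add: sets_obs_law)

end

lemma AQC_le_deterministic:
  fixes M :: "'a::countable pomc"
  assumes "measure (obs_run M A x t) E - measure (obs_run M A y t) E \<ge> 1/3"
  shows "AQC M x y \<le> enat t"
proof -
  have A: "A \<in> space strategy_space" by (simp add: strategy_space_def space_PiM)
  let ?\<mu> = "return strategy_space A"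
  have mu: "?\<mu> \<in> rewinding_strategies"
    using A by (simp add: rewinding_strategies_def space_prob_algebra prob_space_return)
  have law: "obs_law M ?\<mu> z t = measure_pmf (obs_run M A z t)" for z
    unfolding obs_law_def by (rule bind_return[OF measurable_obs_run A])
  have bdd: "bdd_above ((\<lambda>E. \<bar>measure (obs_run M A x t) E - measure (obs_run M A y t) E\<bar>) ` UNIV)"
  proof (rule bdd_aboveI2)
    fix E
    have "0 \<le> measure (obs_run M A z t) E \<and> measure (obs_run M A z t) E \<le> 1" for z by simp
    from this[of x] this[of y]
    show "\<bar>measure (obs_run M A x t) E - measure (obs_run M A y t) E\<bar> \<le> 1" by linarith
  qed
  have "1/3 \<le> tv_dist (obs_law M ?\<mu> x t) (obs_law M ?\<mu> y t)"
    unfolding tv_dist_def law using cSUP_upper[OF _ bdd, of E] assms by simp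
  then have "QC M ?\<mu> x y \<le> enat t" unfolding QC_def by (intro Inf_lower) auto
  with mu show ?thesis unfolding AQC_def by (rule INF_lower2)
qed

text \<open>If each query adds at most \<open>\<delta>\<close> to the distance, reaching 1/3 within
  \<open>t\<close> queries forces \<open>t * \<delta> \<ge> 1/3\<close>. The ceiling in the proof
  turns this real bound into an extended natural.\<close>

lemma NAQC_geI:
  fixes M :: "'a::countable pomc"
  assumes "\<And>r E t. \<bar>measure (obs_run M (\<lambda>h. r (length h)) x t) E
                  - measure (obs_run M (\<lambda>h. r (length h)) y t) E\<bar> \<le> real t * \<delta>"
    and "\<delta> > 0"
  shows "ereal_of_enat (NAQC M x y) \<ge> ereal (1 / (3 * \<delta>))"
proof -
  have "enat (nat \<lceil>1 / (3 * \<delta>)\<rceil>) \<le> NAQC M x y"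
    unfolding NAQC_def QC_def
  proof (safe intro!: INF_greatest Inf_greatest)
    fix \<mu> t
    assume mu: "\<mu> \<in> rewinding_strategies" "nonadaptive \<mu>"
      and tv: "1/3 \<le> tv_dist (obs_law M \<mu> x t) (obs_law M \<mu> y t)"
    have "AE A in \<mu>. \<forall>E. \<bar>measure (obs_run M A x t) E - measure (obs_run M A y t) E\<bar> \<le> real t * \<delta>"
      using mu(2) unfolding nonadaptive_def
    proof eventually_elim
      case (elim A)
      \<comment> \<open>Any history of length \<open>l\<close> could serve as representative, since
        \<open>A\<close> sees only the length.\<close>
      define r where "r l = A (replicate l True)" for l
      have "A = (\<lambda>h. r (length h))"
        using elim unfolding r_def fun_eq_iff by (metis length_replicate)
      then show ?case using assms(1) by metis
    qed
    from order_trans[OF tv tv_dist_obs_law_le[OF mu(1) this]]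
    have "1 / (3 * \<delta>) \<le> real t" using assms(2) by (simp add: field_simps)
    then show "enat (nat \<lceil>1 / (3 * \<delta>)\<rceil>) \<le> enat t" by (simp add: nat_le_iff ceiling_le_iff)
  qed
  then have "ereal_of_enat (enat (nat \<lceil>1 / (3 * \<delta>)\<rceil>)) \<le> ereal_of_enat (NAQC M x y)"
    by (simp only: ereal_of_enat_le_iff)
  moreover have "ereal (1 / (3 * \<delta>)) \<le> ereal_of_enat (enat (nat \<lceil>1 / (3 * \<delta>)\<rceil>))"
    using real_nat_ceiling_ge[of "1 / (3 * \<delta>)"] by simp
  ultimately show ?thesis by (rule order_trans[rotated])
qed

lemma length_run: "xs \<in> set_pmf (run M A x t) \<Longrightarrow> length xs = Suc t"
  by (induction t arbitrary: xs) auto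

section \<open>The descending chain\<close>

text \<open>Truncated subtraction makes 0 absorbing on success as well as on failure.\<close>

definition descending_chain :: "nat \<Rightarrow> real \<Rightarrow> nat pomc" where
  "descending_chain n p =
     \<lparr>states = {..<n}, trans = (\<lambda>k. map_pmf (\<lambda>s. if s then k - 1 else 0) (bernoulli_pmf p)), sink = 0\<rparr>"

lemma states_descending_chain [simp]: "states (descending_chain n p) = {..<n}"
  and trans_descending_chain [simp]:
    "trans (descending_chain n p) k = map_pmf (\<lambda>s. if s then k - 1 else 0) (bernoulli_pmf p)"
  and sink_descending_chain [simp]: "sink (descending_chain n p) = 0"
  and observe_descending_chain [simp]: "observe (descending_chain n p) = (\<lambda>x. x = 0)"
  by (auto simp: descending_chain_def observe_def)

lemma canonical_descending_chain: "n > 0 \<Longrightarrow> canonical_pomc (descending_chain n p)"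
  by (auto simp: canonical_pomc_def map_pmf_const cong: if_cong)

text \<open>The newest observation comes last, so the number of trailing sink observations is the
  distance back to the last unsunk state.\<close>

definition rewind_to_last_unsunk :: strategy where
  "rewind_to_last_unsunk h = length (takeWhile id (rev h))"

definition unsunk :: "nat list \<Rightarrow> nat" where
  "unsunk xs = length (filter (\<lambda>k. k \<noteq> 0) xs)"

lemma rewind_to_last_unsunk_snoc [simp]:
  "rewind_to_last_unsunk (h @ [s]) = (if s then Suc (rewind_to_last_unsunk h) else 0)"
  by (simp add: rewind_to_last_unsunk_def)

lemma unsunk_snoc [simp]: "unsunk (xs @ [k]) = (if k = 0 then unsunk xs else Suc (unsunk xs))"
  by (simp add: unsunk_def)

context
  fixes n :: nat and p :: real
  assumes p: "0 \<le> p" "p \<le> 1"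
begin

abbreviation "chain \<equiv> descending_chain n p"

subsection \<open>Non-adaptive strategies\<close>

text \<open>A query is a success with probability \<open>p\<close>, and reaching level \<open>k\<close> takes \<open>x - k\<close>
  successes along the branch of the query tree, which is fixed in advance.\<close>

lemma emeasure_nonadaptive_level:
  assumes "0 < k" "i \<le> t"
  shows "emeasure (run chain (\<lambda>h. r (length h)) x t) {xs. xs ! i = k} \<le> ennreal (p ^ (x - k))"
  using assms
proof (induction t arbitrary: i k)
  case 0
  then show ?case using p by (auto simp: indicator_def)
next
  case (Suc t)
  let ?run = "run chain (\<lambda>h. r (length h)) x t"
  let ?step = "\<lambda>xs. map_pmf (\<lambda>y. xs @ [y]) (trans chain (xs ! (t - r (length xs))))"
  have run_Suc: "emeasure (run chain (\<lambda>h. r (length h)) x (Suc t)) {xs. xs ! i = k} =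
      (\<integral>\<^sup>+xs. emeasure (?step xs) {ys. ys ! i = k} \<partial>?run)"
    by simp
  show ?case
  proof (cases "i \<le> t")
    case True
    have "(\<integral>\<^sup>+xs. emeasure (?step xs) {ys. ys ! i = k} \<partial>?run)
        = (\<integral>\<^sup>+xs. indicator {xs. xs ! i = k} xs \<partial>?run)"
    proof (intro nn_integral_cong_AE AE_pmfI)
      fix xs assume "xs \<in> set_pmf ?run"
      with True have "i < length xs" using length_run by fastforce
      then have "(\<lambda>s. xs @ [f s]) -` {ys. ys ! i = k} = (if xs ! i = k then UNIV else {})"
        for f :: "bool \<Rightarrow> nat"
        by (auto simp: nth_append)
      then show "emeasure (?step xs) {ys. ys ! i = k} = indicator {xs. xs ! i = k} xs"
        by (simp add: map_pmf_comp measure_pmf.emeasure_space_1[simplified])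
    qed
    then show ?thesis using Suc.IH[OF Suc.prems(1) True] run_Suc by simp
  next
    case False
    then have i: "i = Suc t" using Suc.prems by simp
    \<comment> \<open>The history at time \<open>t\<close> has \<open>Suc t\<close> entries, so the
      queried index is the same for all histories.\<close>
    let ?j = "t - r (Suc t)"
    have "(\<integral>\<^sup>+xs. emeasure (?step xs) {ys. ys ! i = k} \<partial>?run)
        = (\<integral>\<^sup>+xs. ennreal p * indicator {xs. xs ! ?j = Suc k} xs \<partial>?run)"
    proof (intro nn_integral_cong_AE AE_pmfI)
      fix xs assume "xs \<in> set_pmf ?run"
      then have l: "length xs = Suc t" by (rule length_run)
      \<comment> \<open>As \<open>k\<close> is positive, the new state is \<open>k\<close> only
        after a success from level \<open>Suc k\<close>.\<close>
      have "(\<lambda>s. xs @ [if s then xs ! ?j - 1 else 0]) -` {ys. ys ! i = k}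
          = (if xs ! ?j = Suc k then {True} else {})"
        using l i \<open>0 < k\<close> by (auto simp: nth_append split: if_splits)
      then show "emeasure (?step xs) {ys. ys ! i = k}
          = ennreal p * indicator {xs. xs ! ?j = Suc k} xs"
        using l p by (simp add: map_pmf_comp emeasure_pmf_single)
    qed
    also have "\<dots> = ennreal p * emeasure ?run {xs. xs ! ?j = Suc k}"
      by (simp add: nn_integral_cmult)
    also have "\<dots> \<le> ennreal (p ^ (x - k))"
    proof (cases "k < x")
      case True
      then have pow: "p ^ (x - k) = p * p ^ (x - Suc k)"
        by (metis Suc_diff_Suc power_Suc)
      have "ennreal p * emeasure ?run {xs. xs ! ?j = Suc k} \<le> ennreal p * ennreal (p ^ (x - Suc k))"
        by (intro mult_left_mono Suc.IH) auto
      then show ?thesis using p by (simp add: pow ennreal_mult)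
    next
      case False
      \<comment> \<open>For \<open>k \<ge> x\<close> the truncated exponent is 0 and the claimed
        bound is 1.\<close>
      have "ennreal p * emeasure ?run {xs. xs ! ?j = Suc k} \<le> 1 * 1"
        using p by (intro mult_mono measure_pmf.emeasure_le_1) (auto simp: ennreal_le_1)
      then show ?thesis using False by simp
    qed
    finally show ?thesis using run_Suc by simp
  qed
qed

text \<open>Union bound over the \<open>t\<close> queries; time 0 contributes nothing because the
  start \<open>x\<close> lies above level 1.\<close>

lemma measure_nonadaptive_level_1:
  assumes "x \<ge> 2"
  shows "measure (run chain (\<lambda>h. r (length h)) x t) {xs. 1 \<in> set xs} \<le> real t * p ^ (x - 1)"
proof -
  let ?P = "measure_pmf (run chain (\<lambda>h. r (length h)) x t)"
  have start: "xs ! 0 = x" if "xs \<in> set_pmf (run chain (\<lambda>h. r (length h)) x t)" for xs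
    using that
  proof (induction t arbitrary: xs)
    case (Suc t)
    then show ?case by (fastforce simp: nth_append dest: length_run)
  qed simp
  have "measure ?P {xs. 1 \<in> set xs} \<le> measure ?P (\<Union>i\<in>{1..t}. {xs. xs ! i = 1})"
  proof (rule measure_pmf.finite_measure_mono_AE)
    show "AE xs in ?P. xs \<in> {xs. 1 \<in> set xs} \<longrightarrow> xs \<in> (\<Union>i\<in>{1..t}. {xs. xs ! i = 1})"
    proof (intro AE_pmfI impI)
      fix xs assume xs: "xs \<in> set_pmf (run chain (\<lambda>h. r (length h)) x t)" "xs \<in> {xs. 1 \<in> set xs}"
      then obtain i where i: "i < Suc t" "xs ! i = 1"
        using length_run by (fastforce simp: in_set_conv_nth)
      moreover have "i \<noteq> 0" using start[OF xs(1)] assms i by (auto intro: ccontr)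
      ultimately show "xs \<in> (\<Union>i\<in>{1..t}. {xs. xs ! i = 1})" by auto
    qed
  qed simp
  also have "\<dots> \<le> (\<Sum>i\<in>{1..t}. measure ?P {xs. xs ! i = 1})"
    by (rule measure_pmf.finite_measure_subadditive_finite) auto
  also have "\<dots> \<le> (\<Sum>i\<in>{1..t}. p ^ (x - 1))"
  proof (rule sum_mono)
    fix i assume "i \<in> {1..t}"
    then show "measure ?P {xs. xs ! i = 1} \<le> p ^ (x - 1)"
      using emeasure_nonadaptive_level[of 1 i t r x] p
      by (simp add: measure_pmf.emeasure_eq_measure)
  qed
  finally show ?thesis by simp
qed

text \<open>Lowering every level by one couples the runs from \<open>x\<close> and from \<open>x - 1\<close>.\<close>

lemma run_nonadaptive_shift:
  "run chain (\<lambda>h. r (length h)) (x - 1) t =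
     map_pmf (map (\<lambda>k. k - 1)) (run chain (\<lambda>h. r (length h)) x t)"
proof (induction t)
  case (Suc t)
  \<comment> \<open>Lowering the levels keeps the length of the history, hence the rewind, and it
    commutes with both outcomes of a query.\<close>
  show ?case
    unfolding run.simps Suc map_bind_pmf bind_map_pmf
    by (intro bind_pmf_cong refl)
      (auto simp: map_pmf_comp nth_map dest!: length_run intro!: map_pmf_cong)
qed simp

text \<open>By the coupling both observation laws are images of the one run from \<open>x\<close>,
  under the tests \<open>k = 0\<close> and \<open>k - 1 = 0\<close>. These disagree only at
  \<open>k = 1\<close>.\<close>

lemma nonadaptive_obs_run_diff:
  assumes "x \<ge> 2"
  shows "\<bar>measure (obs_run chain (\<lambda>h. r (length h)) x t) E
        - measure (obs_run chain (\<lambda>h. r (length h)) (x - 1) t) E\<bar> \<le> real t * p ^ (x - 1)"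
proof -
  let ?P = "measure_pmf (run chain (\<lambda>h. r (length h)) x t)"
  let ?X = "map (\<lambda>k. k = (0::nat)) -` E" and ?Y = "map (\<lambda>k. k - 1 = (0::nat)) -` E"
  have eq: "xs \<in> ?X \<longleftrightarrow> xs \<in> ?Y" if "1 \<notin> set xs" for xs
  proof -
    have "map (\<lambda>k. k = 0) xs = map (\<lambda>k. k - 1 = 0) xs"
      using that by (intro map_cong) (auto simp: le_Suc_eq)
    then show ?thesis by (simp only: vimage_eq)
  qed
  have le: "measure ?P U \<le> measure ?P V + measure ?P {xs. 1 \<in> set xs}"
    if "\<And>xs. 1 \<notin> set xs \<Longrightarrow> xs \<in> U \<Longrightarrow> xs \<in> V" for U V
  proof -
    have "measure ?P U \<le> measure ?P (V \<union> {xs. 1 \<in> set xs})"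
      using that by (intro measure_pmf.finite_measure_mono) auto
    also have "\<dots> \<le> measure ?P V + measure ?P {xs. 1 \<in> set xs}"
      by (rule measure_Un_le) auto
    finally show ?thesis .
  qed
  have "\<bar>measure ?P ?X - measure ?P ?Y\<bar> \<le> measure ?P {xs. 1 \<in> set xs}"
    using le[of ?X ?Y] le[of ?Y ?X] eq by (auto simp: abs_le_iff)
  also have "\<dots> \<le> real t * p ^ (x - 1)" by (rule measure_nonadaptive_level_1[OF assms])
  finally show ?thesis
    unfolding obs_run_def run_nonadaptive_shift by (simp add: map_pmf_comp o_def)
qed

subsection \<open>Adaptive strategy\<close>

text \<open>Each new unsunk state lies one level below the previous one, and a sunk state changes
  neither the last unsunk level nor the count; initially the level is \<open>x\<close> and the count
  1. Positivity then caps the count at \<open>x\<close>.\<close>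

lemma run_rewind_to_last_unsunk:
  assumes "0 < x" "xs \<in> set_pmf (run chain rewind_to_last_unsunk x t)"
  shows "xs ! (t - rewind_to_last_unsunk (map (\<lambda>k. k = 0) xs)) + unsunk xs = Suc x"
    and "0 < xs ! (t - rewind_to_last_unsunk (map (\<lambda>k. k = 0) xs))"
proof -
  have "xs ! (t - rewind_to_last_unsunk (map (\<lambda>k. k = 0) xs)) + unsunk xs = Suc x \<and>
      0 < xs ! (t - rewind_to_last_unsunk (map (\<lambda>k. k = 0) xs))"
    using assms(2)
  proof (induction t arbitrary: xs)
    case 0
    then show ?case using assms(1) by (simp add: unsunk_def)
  next
    case (Suc t)
    then obtain ys s where ys: "ys \<in> set_pmf (run chain rewind_to_last_unsunk x t)"
      and xs: "xs = ys @ [if s then ys ! (t - rewind_to_last_unsunk (map (\<lambda>k. k = 0) ys)) - 1 else 0]"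
      by (auto simp only: run.simps set_bind_pmf set_map_pmf trans_descending_chain
          observe_descending_chain)
    show ?case using Suc.IH[OF ys] length_run[OF ys] by (auto simp: xs nth_append)
  qed
  then show "xs ! (t - rewind_to_last_unsunk (map (\<lambda>k. k = 0) xs)) + unsunk xs = Suc x"
    and "0 < xs ! (t - rewind_to_last_unsunk (map (\<lambda>k. k = 0) xs))" by auto
qed

text \<open>The integrand is a supermartingale: while fewer than \<open>x\<close> unsunk states have been seen, a
  query raises the first summand by at most \<open>p\<close> and lowers the second one by \<open>p\<close> on average.\<close>

lemma adaptive_supermartingale:
  assumes "0 < x"
  shows "(\<integral>\<^sup>+xs. ennreal (real t * p * of_bool (unsunk xs < x) + real (x - unsunk xs))
            \<partial>run chain rewind_to_last_unsunk x t) \<le> ennreal (real (x - 1))"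
proof (induction t)
  case 0
  then show ?case using assms by (simp add: unsunk_def)
next
  case (Suc t)
  let ?\<phi> = "\<lambda>t xs. real t * p * of_bool (unsunk xs < x) + real (x - unsunk xs)"
  let ?run = "run chain rewind_to_last_unsunk x t"
  let ?k = "\<lambda>xs. xs ! (t - rewind_to_last_unsunk (map (\<lambda>k. k = 0) xs))"
  have "(\<integral>\<^sup>+xs. ennreal (?\<phi> (Suc t) xs) \<partial>run chain rewind_to_last_unsunk x (Suc t)) =
     (\<integral>\<^sup>+xs. (ennreal (?\<phi> (Suc t) (xs @ [?k xs - 1])) * ennreal p
           + ennreal (?\<phi> (Suc t) (xs @ [0])) * ennreal (1 - p)) \<partial>?run)"
    using p by (simp add: map_pmf_comp del: of_nat_Suc)
  also have "\<dots> \<le> (\<integral>\<^sup>+xs. ennreal (?\<phi> t xs) \<partial>?run)"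
  proof (intro nn_integral_mono_AE AE_pmfI)
    fix xs assume "xs \<in> set_pmf ?run"
    note inv = run_rewind_to_last_unsunk[OF assms this]
    have "?\<phi> (Suc t) (xs @ [?k xs - 1]) * p + ?\<phi> (Suc t) (xs @ [0]) * (1 - p) \<le> ?\<phi> t xs"
    proof (cases "unsunk xs < x")
      case True
      \<comment> \<open>By the invariant the current level is at least 2, so a success reaches
        another unsunk state.\<close>
      then have k: "?k xs - 1 \<noteq> 0" using inv by auto
      have T: "?\<phi> (Suc t) (xs @ [?k xs - 1]) \<le> real (Suc t) * p + (real x - real (unsunk xs) - 1)"
        using True k p by (auto simp: of_nat_diff)
      have F: "?\<phi> (Suc t) (xs @ [0]) = real (Suc t) * p + (real x - real (unsunk xs))"
        using True by (simp add: of_nat_diff)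
      have "?\<phi> (Suc t) (xs @ [?k xs - 1]) * p + ?\<phi> (Suc t) (xs @ [0]) * (1 - p)
        \<le> (real (Suc t) * p + (real x - real (unsunk xs) - 1)) * p
          + (real (Suc t) * p + (real x - real (unsunk xs))) * (1 - p)"
        unfolding F using p by (intro add_mono mult_right_mono T) auto
      also have "\<dots> = ?\<phi> t xs" using True by (simp add: of_nat_diff algebra_simps)
      finally show ?thesis .
    next
      case False
      \<comment> \<open>Here the count is exactly \<open>x\<close> and the level is 1: both outcomes
        sink and the integrand stays 0.\<close>
      then show ?thesis using inv by auto
    qed
    then show "ennreal (?\<phi> (Suc t) (xs @ [?k xs - 1])) * ennreal p
           + ennreal (?\<phi> (Suc t) (xs @ [0])) * ennreal (1 - p) \<le> ennreal (?\<phi> t xs)"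
      using p by (simp add: ennreal_mult[symmetric] ennreal_plus[symmetric] ennreal_leI
          del: ennreal_plus unsunk_snoc of_nat_Suc)
  qed
  also note Suc
  finally show ?case .
qed

text \<open>Markov-type bound: discard the second, nonnegative summand of the
  supermartingale.\<close>

lemma measure_adaptive_unsunk_less:
  assumes "0 < x"
  shows "real t * p * measure (run chain rewind_to_last_unsunk x t) {xs. unsunk xs < x} \<le> real (x - 1)"
proof -
  let ?P = "run chain rewind_to_last_unsunk x t"
  have "ennreal (real t * p * measure ?P {xs. unsunk xs < x})
      = (\<integral>\<^sup>+xs. ennreal (real t * p) * indicator {xs. unsunk xs < x} xs \<partial>?P)"
    using p by (simp add: nn_integral_cmult ennreal_mult measure_pmf.emeasure_eq_measure)
  also have "\<dots> \<le> (\<integral>\<^sup>+xs. ennreal (real t * p * of_bool (unsunk xs < x) + real (x - unsunk xs)) \<partial>?P)"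
    by (intro nn_integral_mono) (use p in \<open>auto simp: indicator_def intro!: ennreal_leI\<close>)
  also note adaptive_supermartingale[OF assms]
  finally show ?thesis by simp
qed

text \<open>The test is to see \<open>x\<close> unsunk observations. From \<open>x - 1\<close> the
  invariant makes this impossible; from \<open>x\<close> it fails with probability at most
  \<open>(x - 1) / (t * p) \<le> 1/2\<close>.\<close>

lemma adaptive_obs_run_diff:
  assumes "x \<ge> 2" and "real t * p \<ge> 2 * real x"
  shows "measure (obs_run chain rewind_to_last_unsunk x t) {h. x \<le> length (filter Not h)}
       - measure (obs_run chain rewind_to_last_unsunk (x - 1) t) {h. x \<le> length (filter Not h)} \<ge> 1/3"
proof -
  let ?E = "{h. x \<le> length (filter Not h)}"
  let ?P = "\<lambda>y. measure_pmf (run chain rewind_to_last_unsunk y t)"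
  have obs: "measure (obs_run chain rewind_to_last_unsunk y t) ?E = measure (?P y) {xs. x \<le> unsunk xs}" for y
    by (simp add: obs_run_def unsunk_def vimage_def filter_map o_def)
  have "measure (?P (x - 1)) {xs. x \<le> unsunk xs} = 0"
    using run_rewind_to_last_unsunk[of "x - 1" _ t] assms(1)
    by (fastforce simp: measure_pmf_zero_iff)
  moreover have "measure (?P x) {xs. x \<le> unsunk xs} \<ge> 1/2"
  proof -
    let ?q = "measure (?P x) {xs. unsunk xs < x}"
    have "2 * real x * ?q \<le> real t * p * ?q" by (intro mult_right_mono assms(2)) simp
    also have "\<dots> \<le> real x" using measure_adaptive_unsunk_less[of x t] assms(1) by simp
    finally have "?q \<le> 1/2" using assms(1) by simp
    moreover have "measure (?P x) {xs. x \<le> unsunk xs} = 1 - ?q"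
      using measure_pmf.prob_compl[of "{xs. unsunk xs < x}" "run chain rewind_to_last_unsunk x t"]
      by (simp add: Compl_eq_Diff_UNIV[symmetric] Collect_neg_eq[symmetric] not_less)
    ultimately show ?thesis by simp
  qed
  ultimately show ?thesis unfolding obs by simp
qed

end

theorem theorem5p1:
  shows "\<exists>(C::real) (c::real) (\<epsilon>::nat \<Rightarrow> real).
    C > 0 \<and> c > 0 \<and> \<epsilon> \<longlonglongrightarrow> 0 \<and>
    (\<forall>n\<ge>3. \<forall>d::real. d \<ge> 1 \<longrightarrow>
      (\<exists>(M :: nat pomc) a b.
        canonical_pomc M \<and> card (states M) = n \<and> a \<in> states M \<and> b \<in> states M \<and>
        ereal_of_enat (AQC M a b) \<le> ereal (C * real n ^ 2 * d) \<and>
        ereal_of_enat (NAQC M a b) \<ge> ereal (c * d powr ((1 - \<epsilon> n) * real n))))"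
proof (intro exI conjI allI impI)
  show "(3::real) > 0" "(1/3::real) > 0" by auto
  \<comment> \<open>This choice turns \<open>(1 - \<epsilon> n) * n\<close> into
    \<open>n - 2\<close>, the number of successes from level \<open>n - 1\<close> down to level
    1.\<close>
  show "(\<lambda>n. 2 / real n) \<longlonglongrightarrow> 0" by (rule lim_const_over_n)
  fix n :: nat and d :: real
  assume n: "n \<ge> 3" and d: "d \<ge> 1"
  define p where "p = 1 / d"
  have p: "0 < p" "p \<le> 1" using d by (auto simp: p_def)
  let ?M = "descending_chain n p"
  show "canonical_pomc ?M" using n by (intro canonical_descending_chain) simp
  show "card (states ?M) = n" "n - 1 \<in> states ?M" "n - 1 - 1 \<in> states ?M" using n by auto
  have x: "n - 1 \<ge> 2" using n by simp

  \<comment> \<open>Enough queries for \<open>t * p \<ge> 2 * x\<close> with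
    \<open>x = n - 1\<close>.\<close>
  let ?t = "nat \<lceil>2 * real (n - 1) * d\<rceil>"
  have t: "2 * real (n - 1) * d \<le> real ?t" by (rule real_nat_ceiling_ge)
  then have "real ?t * p \<ge> 2 * real (n - 1)" using d by (simp add: p_def field_simps)
  from AQC_le_deterministic[OF adaptive_obs_run_diff[OF _ _ x this]]
  have "AQC ?M (n - 1) (n - 1 - 1) \<le> enat ?t" using p by simp
  then have "ereal_of_enat (AQC ?M (n - 1) (n - 1 - 1)) \<le> ereal_of_enat (enat ?t)"
    by (simp only: ereal_of_enat_le_iff)
  also have "\<dots> \<le> ereal (3 * real n ^ 2 * d)"
  proof -
    have "real ?t \<le> 2 * real (n - 1) * d + 1" using d by simp
    also have "\<dots> \<le> 2 * real n * d + real n * d"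
    proof -
      have "1 * 1 \<le> real n * d" using n d by (intro mult_mono) auto
      then show ?thesis using d by (intro add_mono mult_right_mono) auto
    qed
    also have "\<dots> = 3 * (real n * 1) * d" by simp
    \<comment> \<open>The bound so far is linear in \<open>n\<close>; it is relaxed to the quadratic
      form of the claim.\<close>
    also have "\<dots> \<le> 3 * (real n * real n) * d"
      using n d by (intro mult_right_mono mult_left_mono) auto
    finally show ?thesis by (simp add: power2_eq_square)
  qed
  finally show "ereal_of_enat (AQC ?M (n - 1) (n - 1 - 1)) \<le> ereal (3 * real n ^ 2 * d)" .

  have "ereal (1 / (3 * p ^ (n - 1 - 1))) \<le> ereal_of_enat (NAQC ?M (n - 1) (n - 1 - 1))"
    using p by (intro NAQC_geI nonadaptive_obs_run_diff x) auto
  moreover have "d powr ((1 - 2 / real n) * real n) = d ^ (n - 2)"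
  proof -
    have "(1 - 2 / real n) * real n = real (n - 2)" using n by (simp add: field_simps of_nat_diff)
    then show ?thesis using d by (simp add: powr_realpow)
  qed
  ultimately show "ereal (1/3 * d powr ((1 - 2 / real n) * real n))
      \<le> ereal_of_enat (NAQC ?M (n - 1) (n - 1 - 1))"
    by (simp add: p_def power_divide numeral_2_eq_2)
qed

end
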